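(* Let $G$ be a connected finite simple graph of order $n\geq 3$. Then $\gamma_{\rm ri2}(G)=n-1$ if and only if $G$ is isomorphic to one of $S_{n-1}$, $S_{n-1}^+$, $S(n-3,1)$ (the latter with $n\geq 4$), and $C_5$.
   Context: A $2$-rainbow independent dominating function (2RiDF) of a graph $G$ is a function $f: V(G)\to\{0,1,2\}$ such that, writing $V_i=\{v: f(v)=i\}$, for each $i\in\{1,2\}$ the set $V_i$ is independent and every vertex $v$ with $f(v)=0$ has a neighbor $u$ with $f(u)=i$. Its weight is the number of vertices with nonzero value, and $\gamma_{\rm ri2}(G)$ is the minimum weight of a 2RiDF of $G$. The star $S_m$ ($m\geq 1$) is the complete bipartite graph $K_{1,m}$ (one center adjacent to $m$ leaves). $S_m^+$ is the graph obtained from $S_m$ by adding a single edge (necessarily joining two leaves). For integers $n\geq m\geq 0$, the double star $S(n,m)$ is the graph with vertex set $\{u_0,u_1,\ldots,u_n,v_0,v_1,\ldots,v_m\}$ and edge set $\{u_0v_0\}\cup\{u_0u_i: 1\le i\le n\}\cup\{v_0v_j:1\le j\le m\}$. $C_5$ is the cycle of length $5$. *)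

theory Defs
  imports "Graph_Theory.Graph_Theory"
begin

definition independent_set :: "('a, 'b) pre_digraph \<Rightarrow> 'a set \<Rightarrow> bool" where
  "independent_set G S \<longleftrightarrow> S \<subseteq> verts G \<and> (\<forall>u\<in>S. \<forall>v\<in>S. \<not> u \<rightarrow>\<^bsub>G\<^esub> v)"

text \<open>The values of \<open>f\<close> outside \<^term>\<open>verts G\<close> are irrelevant in the following definitions.\<close>

definition value_class :: "('a, 'b) pre_digraph \<Rightarrow> ('a \<Rightarrow> nat) \<Rightarrow> nat \<Rightarrow> 'a set" where
  "value_class G f i = {v \<in> verts G. f v = i}"

definition ri2_dominating :: "('a, 'b) pre_digraph \<Rightarrow> ('a \<Rightarrow> nat) \<Rightarrow> bool" where
  "ri2_dominating G f \<longleftrightarrow>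
     f ` verts G \<subseteq> {0, 1, 2} \<and>
     (\<forall>i\<in>{1, 2}. independent_set G (value_class G f i) \<and>
        (\<forall>v\<in>value_class G f 0. \<exists>u\<in>value_class G f i. v \<rightarrow>\<^bsub>G\<^esub> u))"

definition ri2_weight :: "('a, 'b) pre_digraph \<Rightarrow> ('a \<Rightarrow> nat) \<Rightarrow> nat" where
  "ri2_weight G f = card {v \<in> verts G. f v \<noteq> 0}"

definition gamma_ri2 :: "('a, 'b) pre_digraph \<Rightarrow> nat" where
  "gamma_ri2 G = (LEAST w. \<exists>f. ri2_dominating G f \<and> ri2_weight G f = w)"

text \<open>
  Undirected graphs are symmetric digraphs; below each edge is listed in one orientation and
  \<^const>\<open>mk_symmetric\<close> adds the other.
\<close>

text \<open>The centre is \<open>0\<close> and the leaves are \<open>1, \<dots>, m\<close>.\<close>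

definition star_graph :: "nat \<Rightarrow> nat pair_pre_digraph" where
  "star_graph m = mk_symmetric (with_proj
     \<lparr> pverts = {0..m}, parcs = {0} \<times> {1..m} \<rparr>)"

text \<open>
  All choices of the added edge give isomorphic graphs. Meaningful only for \<open>m \<ge> 2\<close>, where
  \<open>1\<close> and \<open>2\<close> are leaves.
\<close>

definition star_plus_graph :: "nat \<Rightarrow> nat pair_pre_digraph" where
  "star_plus_graph m = mk_symmetric (with_proj
     \<lparr> pverts = {0..m}, parcs = {0} \<times> {1..m} \<union> {(1, 2)} \<rparr>)"

text \<open>The vertex \<open>u\<^sub>i\<close> is \<^term>\<open>Inl i\<close>, and \<open>v\<^sub>j\<close> is \<^term>\<open>Inr j\<close>.\<close>

definition double_star_graph :: "nat \<Rightarrow> nat \<Rightarrow> (nat + nat) pair_pre_digraph" where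
  "double_star_graph n m = mk_symmetric (with_proj
     \<lparr> pverts = Inl ` {0..n} \<union> Inr ` {0..m},
       parcs = {(Inl 0, Inr 0)} \<union> {(Inl 0, Inl i) | i. i \<in> {1..n}} \<union> {(Inr 0, Inr j) | j. j \<in> {1..m}} \<rparr>)"

definition cycle_graph :: "nat \<Rightarrow> nat pair_pre_digraph" where
  "cycle_graph k = mk_symmetric (with_proj
     \<lparr> pverts = {0..<k}, parcs = {(i, (i + 1) mod k) | i. i < k} \<rparr>)"

end

theory Submission
  imports Defs
begin

text \<open>
  Any two disjoint independent sets \<open>A\<close>, \<open>B\<close> extend greedily to the colour classes of a 2RiDF, and a
  vertex with a neighbour in each of them must receive the value \<open>0\<close>. Hence, as soon as some vertex
  has two neighbours, the domination number is \<open>n - 1\<close> iff \<open>G\<close> has no rainbow pair: two vertices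
  \<open>x \<noteq> y\<close> with neighbours \<open>a, b\<close> and \<open>a', b'\<close> respectively, where \<open>{a, a'}\<close> and \<open>{b, b'}\<close> are
  independent and disjoint. Without rainbow pairs, two neighbours \<open>x, y\<close> of a vertex \<open>a\<close> have all
  their other neighbours joined to each other; in particular \<open>G\<close> has no 4-cycle. Apply this around a
  vertex \<open>c\<close> of maximum degree. If \<open>c\<close> is universal, at most one edge avoids \<open>c\<close>. Otherwise take
  \<open>w\<close> at distance 2 from \<open>c\<close>: a second neighbour of \<open>w\<close> closes a 5-cycle and forces maximum degree
  2, and if there is none, \<open>G\<close> is a double star.
\<close>

(* As an elimination rule this replaces every adjacency by an arc, which makes classical search diverge. *)
declare reachableE [rule del]

section \<open>Rainbow pairs\<close>

definition rainbow_pair :: "('a, 'b) pre_digraph \<Rightarrow> bool" where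
  "rainbow_pair G \<longleftrightarrow> (\<exists>x y a a' b b'. x \<noteq> y \<and>
     x \<rightarrow>\<^bsub>G\<^esub> a \<and> x \<rightarrow>\<^bsub>G\<^esub> b \<and> y \<rightarrow>\<^bsub>G\<^esub> a' \<and> y \<rightarrow>\<^bsub>G\<^esub> b' \<and>
     \<not> a \<rightarrow>\<^bsub>G\<^esub> a' \<and> \<not> b \<rightarrow>\<^bsub>G\<^esub> b' \<and> a \<noteq> b \<and> a \<noteq> b' \<and> a' \<noteq> b \<and> a' \<noteq> b')"

lemma rainbow_pairI:
  assumes "x \<noteq> y" "x \<rightarrow>\<^bsub>G\<^esub> a" "x \<rightarrow>\<^bsub>G\<^esub> b" "y \<rightarrow>\<^bsub>G\<^esub> a'" "y \<rightarrow>\<^bsub>G\<^esub> b'" "\<not> a \<rightarrow>\<^bsub>G\<^esub> a'" "\<not> b \<rightarrow>\<^bsub>G\<^esub> b'"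
    "a \<noteq> b" "a \<noteq> b'" "a' \<noteq> b" "a' \<noteq> b'"
  shows "rainbow_pair G"
  unfolding rainbow_pair_def
  by (rule exI[of _ x], rule exI[of _ y], rule exI[of _ a], rule exI[of _ a'],
      rule exI[of _ b], rule exI[of _ b']) (simp add: assms)

text \<open>If \<open>a = y\<close>, the edge from \<open>y\<close> to \<open>a'\<close> would lie
  inside the first colour pair; the other three extra inequalities hold for the same reason, up to
  symmetry of adjacency. They keep \<open>x\<close> and \<open>y\<close> out of the colour
  pairs.\<close>

lemma rainbow_pairE:
  assumes "rainbow_pair G" "symmetric G"
  obtains x y a a' b b'
  where "x \<noteq> y" "x \<rightarrow>\<^bsub>G\<^esub> a" "x \<rightarrow>\<^bsub>G\<^esub> b" "y \<rightarrow>\<^bsub>G\<^esub> a'" "y \<rightarrow>\<^bsub>G\<^esub> b'" "\<not> a \<rightarrow>\<^bsub>G\<^esub> a'" "\<not> b \<rightarrow>\<^bsub>G\<^esub> b'"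
    "a \<noteq> b" "a \<noteq> b'" "a' \<noteq> b" "a' \<noteq> b'" "a \<noteq> y" "b \<noteq> y" "a' \<noteq> x" "b' \<noteq> x"
proof -
  obtain x y a a' b b' where *: "x \<noteq> y" "x \<rightarrow>\<^bsub>G\<^esub> a" "x \<rightarrow>\<^bsub>G\<^esub> b" "y \<rightarrow>\<^bsub>G\<^esub> a'" "y \<rightarrow>\<^bsub>G\<^esub> b'"
    "\<not> a \<rightarrow>\<^bsub>G\<^esub> a'" "\<not> b \<rightarrow>\<^bsub>G\<^esub> b'" "a \<noteq> b" "a \<noteq> b'" "a' \<noteq> b" "a' \<noteq> b'"
    using assms(1) unfolding rainbow_pair_def by (elim exE conjE) (rule that)
  have "a \<noteq> y" "b \<noteq> y" using * by auto
  moreover have "a' \<noteq> x" "b' \<noteq> x"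
    using * arcs_ends_symmetric[OF assms(2)] by auto
  ultimately show thesis using * by (intro that)
qed

subsection \<open>Isomorphisms\<close>

text \<open>Without parallel arcs an arc is determined by its ends, so a vertex bijection that
  preserves and reflects adjacency lifts to arcs. The last hypothesis rules out arcs of
  \<open>H\<close> with an end that is not a vertex.\<close>

lemma (in nomulti_digraph) digraph_iso_with_projI:
  assumes h: "bij_betw h (verts G) (pverts H)"
    and adj: "\<And>u v. u \<in> verts G \<Longrightarrow> v \<in> verts G \<Longrightarrow> u \<rightarrow>\<^bsub>G\<^esub> v \<longleftrightarrow> (h u, h v) \<in> parcs H"
    and H: "parcs H \<subseteq> pverts H \<times> pverts H"
  shows "digraph_iso G (with_proj H)"
proof -
  define g where "g = (\<lambda>e. (h (tail G e), h (head G e)))"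
  let ?f = "\<lparr>iso_verts = h, iso_arcs = g, iso_head = snd, iso_tail = fst\<rparr>"
  have inj_h: "inj_on h (verts G)" and img: "h ` verts G = pverts H"
    using h by (auto simp: bij_betw_def)
  have "inj_on g (arcs G)"
  proof (rule inj_onI)
    fix e e' assume e: "e \<in> arcs G" "e' \<in> arcs G" "g e = g e'"
    then have "tail G e = tail G e'" "head G e = head G e'"
      using inj_h by (auto simp: g_def dest: inj_onD)
    then show "e = e'"
      using e no_multi_arcs by (auto simp: arc_to_ends_def)
  qed
  moreover have "g ` arcs G = parcs H"
  proof (intro equalityI subsetI)
    fix p assume "p \<in> g ` arcs G"
    then obtain e where e: "e \<in> arcs G" "p = g e" by auto
    then have "tail G e \<rightarrow>\<^bsub>G\<^esub> head G e" by (auto simp: arcs_ends_conv)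
    then show "p \<in> parcs H" using adj e by (auto simp: g_def)
  next
    fix p assume p: "p \<in> parcs H"
    then obtain u v where uv: "u \<in> verts G" "v \<in> verts G" "p = (h u, h v)"
      using H img by blast
    then have "u \<rightarrow>\<^bsub>G\<^esub> v" using adj p by auto
    then show "p \<in> g ` arcs G" using uv by (auto simp: arcs_ends_conv g_def)
  qed
  ultimately have "digraph_isomorphism ?f" "with_proj H = app_iso ?f G"
    using inj_h img wf_digraph
    by (auto simp: digraph_isomorphism_def g_def app_iso_def with_proj_def)
  then show ?thesis unfolding digraph_iso_def by blast
qed

text \<open>Tail and head in \<open>with_proj H\<close> are the two projections, so the image of an
  arc must be the pair of images of its ends.\<close>

lemma (in wf_digraph) digraph_iso_with_projD:
  assumes "digraph_iso G (with_proj H)"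
  shows "\<exists>h. bij_betw h (verts G) (pverts H) \<and>
    (\<forall>u\<in>verts G. \<forall>v\<in>verts G. u \<rightarrow>\<^bsub>G\<^esub> v \<longleftrightarrow> (h u, h v) \<in> parcs H)"
proof -
  obtain f where f: "digraph_isomorphism f" and H: "with_proj H = app_iso f G"
    using assms by (auto simp: digraph_iso_def)
  let ?h = "iso_verts f"
  have inj: "inj_on ?h (verts G)" using f by (simp add: digraph_isomorphism_inj_on_verts)
  have V: "pverts H = ?h ` verts G" and E: "parcs H = iso_arcs f ` arcs G"
    and fs: "iso_tail f = fst" "iso_head f = snd"
    using arg_cong[OF H, of verts] arg_cong[OF H, of arcs]
      arg_cong[OF H, of tail] arg_cong[OF H, of head] by simp_all
  have arc: "iso_arcs f e = (?h (tail G e), ?h (head G e))" if "e \<in> arcs G" for e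
    using iso_verts_tail[OF f that] iso_verts_head[OF f that] fs by (simp add: prod_eq_iff)
  show ?thesis
  proof (intro exI conjI ballI)
    show "bij_betw ?h (verts G) (pverts H)" using inj V by (simp add: bij_betw_def)
    fix u v assume uv: "u \<in> verts G" "v \<in> verts G"
    show "u \<rightarrow>\<^bsub>G\<^esub> v \<longleftrightarrow> (?h u, ?h v) \<in> parcs H"
    proof
      assume "u \<rightarrow>\<^bsub>G\<^esub> v"
      then obtain e where "e \<in> arcs G" "tail G e = u" "head G e = v" by (rule reachableE)
      then show "(?h u, ?h v) \<in> parcs H" using arc[of e] E by (metis imageI)
    next
      assume "(?h u, ?h v) \<in> parcs H"
      then obtain e where e: "e \<in> arcs G" "iso_arcs f e = (?h u, ?h v)" by (auto simp: E)
      then have "tail G e = u" "head G e = v" using arc uv inj by (auto dest: inj_onD)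
      then show "u \<rightarrow>\<^bsub>G\<^esub> v" using e by (auto simp: arcs_ends_conv)
    qed
  qed
qed

text \<open>A rainbow pair is described by adjacencies, non-adjacencies and inequalities of
  vertices, all of which the vertex bijection carries over.\<close>

lemma (in wf_digraph) rainbow_pair_iso:
  assumes iso: "digraph_iso G (with_proj H)" and "rainbow_pair G"
  shows "rainbow_pair (with_proj H)"
proof -
  obtain h where h: "bij_betw h (verts G) (pverts H)"
    and adj: "\<forall>u\<in>verts G. \<forall>v\<in>verts G. u \<rightarrow>\<^bsub>G\<^esub> v \<longleftrightarrow> (h u, h v) \<in> parcs H"
    using digraph_iso_with_projD[OF iso] by (elim exE conjE) (rule that)
  have inj: "h u = h v \<longleftrightarrow> u = v" if "u \<in> verts G" "v \<in> verts G" for u v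
    using inj_on_eq_iff[OF bij_betw_imp_inj_on[OF h]] that by simp
  obtain x y a a' b b' where *: "x \<noteq> y" "x \<rightarrow>\<^bsub>G\<^esub> a" "x \<rightarrow>\<^bsub>G\<^esub> b" "y \<rightarrow>\<^bsub>G\<^esub> a'" "y \<rightarrow>\<^bsub>G\<^esub> b'"
    "\<not> a \<rightarrow>\<^bsub>G\<^esub> a'" "\<not> b \<rightarrow>\<^bsub>G\<^esub> b'" "a \<noteq> b" "a \<noteq> b'" "a' \<noteq> b" "a' \<noteq> b'"
    using assms(2) unfolding rainbow_pair_def by (elim exE conjE) (rule that)
  have V: "x \<in> verts G" "y \<in> verts G" "a \<in> verts G" "a' \<in> verts G" "b \<in> verts G" "b' \<in> verts G"
    using adj_in_verts[OF *(2)] adj_in_verts[OF *(3)] adj_in_verts[OF *(4)] adj_in_verts[OF *(5)]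
    by simp_all
  show ?thesis
    by (rule rainbow_pairI[where x = "h x" and y = "h y" and a = "h a" and b = "h b" and a' = "h a'" and b' = "h b'"])
      (simp_all add: * V inj adj[rule_format, symmetric])
qed

text \<open>Serves to build isomorphisms onto graphs on an initial segment of the naturals: the
  distinguished vertices receive the first labels. The labelling is the position in
  \<open>xs\<close> followed by a list of the other elements.\<close>

lemma enumeration_with_prefix:
  assumes "finite V" "distinct xs" "set xs \<subseteq> V"
  obtains h where "bij_betw h V {..<card V}" "\<And>i. i < length xs \<Longrightarrow> h (xs ! i) = i"
proof -
  obtain ys where ys: "set ys = V - set xs" "distinct ys"
    using assms finite_distinct_list[of "V - set xs"] by auto
  let ?zs = "xs @ ys"
  have zs: "distinct ?zs" "set ?zs = V" using assms ys by auto
  then have len: "length ?zs = card V" using distinct_card[OF zs(1)] by simp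
  have bij: "bij_betw ((!) ?zs) {..<card V} V"
    using zs len by (intro bij_betw_nth) auto
  show thesis
  proof
    show "bij_betw (the_inv_into {..<card V} ((!) ?zs)) V {..<card V}"
      using bij by (rule bij_betw_the_inv_into)
    fix i assume i: "i < length xs"
    then have "i \<in> {..<card V}" using len by simp
    with bij have "the_inv_into {..<card V} ((!) ?zs) (?zs ! i) = i"
      by (intro the_inv_into_f_f) (auto simp: bij_betw_def)
    then show "the_inv_into {..<card V} ((!) ?zs) (xs ! i) = i" using i by (simp add: nth_append)
  qed
qed

subsection \<open>The extremal graphs\<close>

lemma parcs_mk_symmetric_with_proj:
  "(u, v) \<in> parcs (mk_symmetric (with_proj H)) \<longleftrightarrow> (u, v) \<in> parcs H \<or> (v, u) \<in> parcs H"
  by (auto simp: parcs_mk_symmetric Bex_def)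

lemma pverts_extremal:
  "pverts (star_graph m) = {..m}"
  "pverts (star_plus_graph m) = {..m}"
  "pverts (double_star_graph k m) = Inl ` {..k} \<union> Inr ` {..m}"
  "pverts (cycle_graph k) = {..<k}"
  by (auto simp: star_graph_def star_plus_graph_def double_star_graph_def cycle_graph_def)

lemma parcs_star:
  "(i, j) \<in> parcs (star_graph m) \<longleftrightarrow> i \<le> m \<and> j \<le> m \<and> (i = 0) \<noteq> (j = 0)"
  unfolding star_graph_def parcs_mk_symmetric_with_proj by auto

lemma parcs_star_plus:
  "m \<ge> 2 \<Longrightarrow> (i, j) \<in> parcs (star_plus_graph m) \<longleftrightarrow>
    i \<le> m \<and> j \<le> m \<and> ((i = 0) \<noteq> (j = 0) \<or> i = 1 \<and> j = 2 \<or> i = 2 \<and> j = 1)"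
  unfolding star_plus_graph_def parcs_mk_symmetric_with_proj by auto

lemma parcs_double_star:
  "(u, v) \<in> parcs (double_star_graph k 1) \<longleftrightarrow>
    u \<in> pverts (double_star_graph k 1) \<and> v \<in> pverts (double_star_graph k 1) \<and>
    (case (u, v) of
      (Inl i, Inl j) \<Rightarrow> (i = 0) \<noteq> (j = 0)
    | (Inr i, Inr j) \<Rightarrow> (i = 0) \<noteq> (j = 0)
    | (Inl i, Inr j) \<Rightarrow> i = 0 \<and> j = 0
    | (Inr i, Inl j) \<Rightarrow> i = 0 \<and> j = 0)"
  unfolding pverts_extremal
  unfolding double_star_graph_def parcs_mk_symmetric_with_proj by (auto split: sum.splits)

lemma parcs_cycle:
  "(i, j) \<in> parcs (cycle_graph k) \<longleftrightarrow> i < k \<and> j = (i + 1) mod k \<or> j < k \<and> i = (j + 1) mod k"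
  unfolding cycle_graph_def parcs_mk_symmetric_with_proj by auto

text \<open>The explicit list of ordered pairs makes statements about the 5-cycle finite
  checks.\<close>

lemma parcs_cycle5:
  "parcs (cycle_graph 5) =
    {(0,1), (1,2), (2,3), (3,4), (4,0), (1,0), (2,1), (3,2), (4,3), (0,4)}" (is "_ = ?S")
proof -
  have "i < 5 \<and> j = (i + 1) mod 5 \<longleftrightarrow> (i, j) \<in> {(0,1), (1,2), (2,3), (3,4), (4,0)}" for i j :: nat
  proof (cases "i < 5")
    case True
    then consider "i = 0" | "i = 1" | "i = 2" | "i = 3" | "i = 4" by linarith
    then show ?thesis by cases (simp_all add: numeral_2_eq_2)
  qed auto
  then have "(i, j) \<in> parcs (cycle_graph 5) \<longleftrightarrow> (i, j) \<in> ?S" for i j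
    unfolding parcs_cycle by (simp only: insert_iff prod.inject empty_iff) blast
  then show ?thesis by (simp only: set_eq_iff split_paired_All) blast
qed

text \<open>Both vertices of a rainbow pair have two distinct neighbours, but only the centre of a
  star can have them.\<close>

lemma not_rainbow_pair_star: "\<not> rainbow_pair (with_proj (star_graph m))"
  unfolding rainbow_pair_def with_proj_simps parcs_star by auto

text \<open>Only the vertices of the triangle 0, 1, 2 can have two neighbours. One of
  \<open>x\<close>, \<open>y\<close> is thus 1 or 2; its two neighbours are the rest of the
  triangle, so the other vertex of the pair would be coloured.\<close>

lemma not_rainbow_pair_star_plus:
  assumes m: "m \<ge> 2"
  shows "\<not> rainbow_pair (with_proj (star_plus_graph m))"
proof
  assume r: "rainbow_pair (with_proj (star_plus_graph m))"
  have sym: "symmetric (with_proj (star_plus_graph m))"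
    unfolding star_plus_graph_def by (rule symmetric_mk_symmetric)
  have nbr: "a = 0 \<or> x = 1 \<and> a = 2 \<or> x = 2 \<and> a = 1"
    if "x \<rightarrow>\<^bsub>with_proj (star_plus_graph m)\<^esub> a" "x \<noteq> 0" for x a
    using that m by (auto simp: parcs_star_plus)
  \<comment> \<open>For \<open>x\<close> in \<open>{1, 2}\<close>, \<open>3 - x\<close> is the other
    end of the added edge.\<close>
  have nbrs: "x = 0 \<or> x \<in> {1, 2} \<and> {a, b} = {0, 3 - x}"
    if "x \<rightarrow>\<^bsub>with_proj (star_plus_graph m)\<^esub> a" "x \<rightarrow>\<^bsub>with_proj (star_plus_graph m)\<^esub> b" "a \<noteq> b" for x a b
    using nbr[OF that(1)] nbr[OF that(2)] that(3) by auto
  show False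
    using r sym
  proof (rule rainbow_pairE)
    fix x y a a' b b'
    assume *: "x \<rightarrow>\<^bsub>with_proj (star_plus_graph m)\<^esub> a" "x \<rightarrow>\<^bsub>with_proj (star_plus_graph m)\<^esub> b"
      "y \<rightarrow>\<^bsub>with_proj (star_plus_graph m)\<^esub> a'" "y \<rightarrow>\<^bsub>with_proj (star_plus_graph m)\<^esub> b'"
      "a \<noteq> b" "a' \<noteq> b'"
      and "x \<noteq> y" "a \<noteq> y" "b \<noteq> y" "a' \<noteq> x" "b' \<noteq> x"
    then show False
      using nbrs[OF *(1,2,5)] nbrs[OF *(3,4,6)] by (auto simp: doubleton_eq_iff)
  qed
qed

text \<open>Only the two centres can have two neighbours. \<open>Inr 0\<close> has just two, one of
  which is \<open>Inl 0\<close>; a pair formed by the centres would therefore use one of its own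
  vertices as a colour vertex.\<close>

lemma not_rainbow_pair_double_star: "\<not> rainbow_pair (with_proj (double_star_graph k 1))"
proof
  let ?G = "with_proj (double_star_graph k 1)"
  assume r: "rainbow_pair ?G"
  have sym: "symmetric ?G"
    unfolding double_star_graph_def by (rule symmetric_mk_symmetric)
  have nbrs: "x = Inl 0 \<or> x = Inr 0 \<and> Inl 0 \<in> {a, b}"
    if "x \<rightarrow>\<^bsub>?G\<^esub> a" "x \<rightarrow>\<^bsub>?G\<^esub> b" "a \<noteq> b" for x a b
    using that unfolding with_proj_simps parcs_double_star pverts_extremal
    by (auto split: sum.splits)
  show False
    using r sym
  proof (rule rainbow_pairE)
    fix x y a a' b b'
    assume *: "x \<rightarrow>\<^bsub>?G\<^esub> a" "x \<rightarrow>\<^bsub>?G\<^esub> b" "y \<rightarrow>\<^bsub>?G\<^esub> a'" "y \<rightarrow>\<^bsub>?G\<^esub> b'" "a \<noteq> b" "a' \<noteq> b'"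
      and "x \<noteq> y" "a \<noteq> y" "b \<noteq> y" "a' \<noteq> x" "b' \<noteq> x"
    then show False
      using nbrs[OF *(1,2,5)] nbrs[OF *(3,4,6)] by blast
  qed
qed

text \<open>If \<open>x\<close> and \<open>y\<close> are adjacent, some colour pair contains an
  edge. If they are at distance 2, either their common neighbour would get both colours or their two
  other neighbours, which are adjacent, would share one.\<close>

lemma not_rainbow_pair_cycle5: "\<not> rainbow_pair (with_proj (cycle_graph 5))"
proof
  let ?G = "with_proj (cycle_graph 5)"
  assume r: "rainbow_pair ?G"
  have sym: "symmetric ?G"
    unfolding cycle_graph_def by (rule symmetric_mk_symmetric)
  \<comment> \<open>Each vertex with its two neighbours, in both orders.\<close>
  define T :: "(nat \<times> nat \<times> nat) set" where
    "T = {(0,1,4), (1,2,0), (2,3,1), (3,4,2), (4,0,3), (0,4,1), (1,0,2), (2,1,3), (3,2,4), (4,3,0)}"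
  have "\<forall>p\<in>arcs_ends ?G. \<forall>q\<in>arcs_ends ?G.
      fst p = fst q \<longrightarrow> snd p \<noteq> snd q \<longrightarrow> (fst p, snd p, snd q) \<in> T"
    unfolding with_proj_simps parcs_cycle5 T_def by simp
  from bspec[OF bspec[OF this]]
  have nbrs: "(x, a, b) \<in> T" if "x \<rightarrow>\<^bsub>?G\<^esub> a" "x \<rightarrow>\<^bsub>?G\<^esub> b" "a \<noteq> b" for x a b
    using that by (metis fst_conv snd_conv)
  have "\<forall>s\<in>T. \<forall>t\<in>T. fst s = fst t \<or> fst (snd s) = snd (snd t) \<or> snd (snd s) = fst (snd t) \<or>
      (fst (snd s), fst (snd t)) \<in> arcs_ends ?G \<or> (snd (snd s), snd (snd t)) \<in> arcs_ends ?G"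
    unfolding with_proj_simps parcs_cycle5 T_def by simp
  from bspec[OF bspec[OF this]]
  have disj: "x = y \<or> a = b' \<or> b = a' \<or> a \<rightarrow>\<^bsub>?G\<^esub> a' \<or> b \<rightarrow>\<^bsub>?G\<^esub> b'"
    if "(x, a, b) \<in> T" "(y, a', b') \<in> T" for x y a a' b b'
    using that by (metis fst_conv snd_conv)
  show False
    using r sym
  proof (rule rainbow_pairE)
    fix x y a a' b b'
    assume *: "x \<rightarrow>\<^bsub>?G\<^esub> a" "x \<rightarrow>\<^bsub>?G\<^esub> b" "y \<rightarrow>\<^bsub>?G\<^esub> a'" "y \<rightarrow>\<^bsub>?G\<^esub> b'" "a \<noteq> b" "a' \<noteq> b'"
      and "x \<noteq> y" "\<not> a \<rightarrow>\<^bsub>?G\<^esub> a'" "\<not> b \<rightarrow>\<^bsub>?G\<^esub> b'" "a \<noteq> b'" "a' \<noteq> b"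
    then show False
      using disj[OF nbrs[OF *(1,2,5)] nbrs[OF *(3,4,6)]] by simp
  qed
qed

subsection \<open>Rainbow domination and rainbow pairs\<close>

context graph
begin

lemma adj_sym: "u \<rightarrow>\<^bsub>G\<^esub> v \<longleftrightarrow> v \<rightarrow>\<^bsub>G\<^esub> u"
  using arcs_ends_symmetric[OF sym_arcs] by blast

lemma adj_neq: "u \<rightarrow>\<^bsub>G\<^esub> v \<Longrightarrow> u \<noteq> v"
  using adj_not_same by blast

lemma independent_set_pair:
  "a \<in> verts G \<Longrightarrow> a' \<in> verts G \<Longrightarrow> \<not> a \<rightarrow>\<^bsub>G\<^esub> a' \<Longrightarrow> independent_set G {a, a'}"
  using adj_sym adj_neq by (auto simp: independent_set_def)

text \<open>Take \<open>M\<close> maximal under inclusion among the independent sets between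
  \<open>S\<close> and \<open>W\<close>: a vertex of \<open>W\<close> outside \<open>M\<close>
  without a neighbour in \<open>M\<close> could be added.\<close>

lemma maximal_independent_set_extends:
  assumes S: "independent_set G S" "S \<subseteq> W" and W: "W \<subseteq> verts G"
  obtains M where "S \<subseteq> M" "M \<subseteq> W" "independent_set G M"
    "\<And>w. w \<in> W \<Longrightarrow> w \<notin> M \<Longrightarrow> \<exists>u\<in>M. w \<rightarrow>\<^bsub>G\<^esub> u"
proof -
  define F where "F = {M. S \<subseteq> M \<and> M \<subseteq> W \<and> independent_set G M}"
  have "finite W" using W finite_verts by (rule finite_subset)
  then have fin: "finite F" by (simp add: F_def)
  have "S \<in> F" using S by (simp add: F_def)
  then obtain M where M: "M \<in> F" and max: "\<forall>N\<in>F. M \<le> N \<longrightarrow> M = N"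
    using finite_has_maximal2[OF fin] by blast
  show thesis
  proof
    show "S \<subseteq> M" "M \<subseteq> W" "independent_set G M" using M by (auto simp: F_def)
    fix w assume w: "w \<in> W" "w \<notin> M"
    show "\<exists>u\<in>M. w \<rightarrow>\<^bsub>G\<^esub> u"
    proof (rule ccontr)
      assume no: "\<not> ?thesis"
      then have "independent_set G (insert w M)"
        using M w W adj_neq adj_sym by (auto simp: F_def independent_set_def)
      then have "insert w M \<in> F" using M w by (auto simp: F_def)
      then show False using max w by blast
    qed
  qed
qed

text \<open>Greedy extension: both colour classes can be enlarged, first \<open>A\<close> inside the complement of
  \<open>B\<close> and then \<open>B\<close> in what remains, until every uncoloured vertex sees both colours.\<close>

lemma ri2_dominating_extends:
  assumes A: "independent_set G A" and B: "independent_set G B" and disj: "A \<inter> B = {}"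
  obtains f where "ri2_dominating G f"
    "\<And>v a b. a \<in> A \<Longrightarrow> b \<in> B \<Longrightarrow> v \<rightarrow>\<^bsub>G\<^esub> a \<Longrightarrow> v \<rightarrow>\<^bsub>G\<^esub> b \<Longrightarrow> f v = 0"
proof -
  have V: "A \<subseteq> verts G" "B \<subseteq> verts G" using A B by (auto simp: independent_set_def)
  obtain M where M: "A \<subseteq> M" "M \<subseteq> verts G - B" "independent_set G M"
    "\<And>w. w \<in> verts G - B \<Longrightarrow> w \<notin> M \<Longrightarrow> \<exists>u\<in>M. w \<rightarrow>\<^bsub>G\<^esub> u"
    using V disj by (rule_tac maximal_independent_set_extends[OF A, of "verts G - B"]) auto
  obtain N where N: "B \<subseteq> N" "N \<subseteq> verts G - M" "independent_set G N"
    "\<And>w. w \<in> verts G - M \<Longrightarrow> w \<notin> N \<Longrightarrow> \<exists>u\<in>N. w \<rightarrow>\<^bsub>G\<^esub> u"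
    using V M(2) by (rule_tac maximal_independent_set_extends[OF B, of "verts G - M"]) auto
  define f :: "'a \<Rightarrow> nat" where "f v = (if v \<in> M then 1 else if v \<in> N then 2 else 0)" for v
  have classes: "value_class G f 1 = M" "value_class G f 2 = N"
    "value_class G f 0 = verts G - M - N"
    using M(2) N(2) by (auto simp: value_class_def f_def)
  have "ri2_dominating G f"
    unfolding ri2_dominating_def
  proof (intro conjI ballI)
    show "f ` verts G \<subseteq> {0, 1, 2}" by (auto simp: f_def)
    fix i :: nat assume i: "i \<in> {1, 2}"
    then show "independent_set G (value_class G f i)" using classes M(3) N(3) by auto
    fix v assume "v \<in> value_class G f 0"
    \<comment> \<open>A vertex of value 0 lies outside \<open>N\<close>, hence outside
      \<open>B\<close>, so the maximality of \<open>M\<close> in the complement of \<open>B\<close>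
      applies to it.\<close>
    then show "\<exists>u\<in>value_class G f i. v \<rightarrow>\<^bsub>G\<^esub> u" using i classes M(4) N(1,4) by auto
  qed
  \<comment> \<open>A neighbour of \<open>a\<close> cannot lie in the independent set
    \<open>M\<close>, nor a neighbour of \<open>b\<close> in \<open>N\<close>.\<close>
  moreover have "f v = 0" if "a \<in> A" "b \<in> B" "v \<rightarrow>\<^bsub>G\<^esub> a" "v \<rightarrow>\<^bsub>G\<^esub> b" for v a b
    using that M(1,3) N(1,3) by (auto simp: f_def independent_set_def)
  ultimately show thesis by (rule that)
qed

section \<open>Bounds on the domination number\<close>

lemma gamma_ri2_le: "ri2_dominating G f \<Longrightarrow> gamma_ri2 G \<le> ri2_weight G f"
  unfolding gamma_ri2_def by (rule Least_le) blast

text \<open>The least weight exists because the greedy extension of two empty classes is a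
  2RiDF.\<close>

lemma gamma_ri2_attained: obtains f where "ri2_dominating G f" "ri2_weight G f = gamma_ri2 G"
proof -
  obtain g where "ri2_dominating G g"
    using ri2_dominating_extends[of "{}" "{}"] by (auto simp: independent_set_def)
  then have "\<exists>w f. ri2_dominating G f \<and> ri2_weight G f = w" by blast
  then have "\<exists>f. ri2_dominating G f \<and> ri2_weight G f = gamma_ri2 G"
    unfolding gamma_ri2_def by (rule LeastI_ex)
  then show thesis using that by blast
qed

lemma ri2_weight_conv: "ri2_weight G f = card (verts G) - card (value_class G f 0)"
proof -
  have "{v \<in> verts G. f v \<noteq> 0} = verts G - value_class G f 0" by (auto simp: value_class_def)
  then show ?thesis
    by (simp add: ri2_weight_def card_Diff_subset value_class_def)
qed

text \<open>The greedy extension of \<open>A\<close> and \<open>B\<close> gives every vertex of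
  \<open>Z\<close> the value 0, and the weight is the order minus the number of zeros.\<close>

lemma gamma_ri2_le_if_rainbow:
  assumes "independent_set G A" "independent_set G B" "A \<inter> B = {}"
    and Z: "\<And>z. z \<in> Z \<Longrightarrow> (\<exists>a\<in>A. z \<rightarrow>\<^bsub>G\<^esub> a) \<and> (\<exists>b\<in>B. z \<rightarrow>\<^bsub>G\<^esub> b)"
  shows "gamma_ri2 G \<le> card (verts G) - card Z"
proof -
  obtain f where f: "ri2_dominating G f"
    "\<And>v a b. a \<in> A \<Longrightarrow> b \<in> B \<Longrightarrow> v \<rightarrow>\<^bsub>G\<^esub> a \<Longrightarrow> v \<rightarrow>\<^bsub>G\<^esub> b \<Longrightarrow> f v = 0"
    using ri2_dominating_extends assms(1-3) by blast
  have "Z \<subseteq> value_class G f 0"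
  proof
    fix z assume "z \<in> Z"
    then obtain a b where "a \<in> A" "b \<in> B" "z \<rightarrow>\<^bsub>G\<^esub> a" "z \<rightarrow>\<^bsub>G\<^esub> b" using Z by blast
    then show "z \<in> value_class G f 0" using f(2) adj_in_verts(1) by (simp add: value_class_def)
  qed
  then have "card Z \<le> card (value_class G f 0)" by (intro card_mono) (simp_all add: value_class_def)
  then show ?thesis using gamma_ri2_le[OF f(1)] ri2_weight_conv[of f] by linarith
qed

lemma gamma_ri2_le_card_minus_2:
  assumes "rainbow_pair G"
  shows "gamma_ri2 G \<le> card (verts G) - 2"
  using assms sym_arcs
proof (rule rainbow_pairE)
  fix x y a a' b b'
  assume *: "x \<noteq> y" "x \<rightarrow>\<^bsub>G\<^esub> a" "x \<rightarrow>\<^bsub>G\<^esub> b" "y \<rightarrow>\<^bsub>G\<^esub> a'" "y \<rightarrow>\<^bsub>G\<^esub> b'"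
    "\<not> a \<rightarrow>\<^bsub>G\<^esub> a'" "\<not> b \<rightarrow>\<^bsub>G\<^esub> b'" "a \<noteq> b" "a \<noteq> b'" "a' \<noteq> b" "a' \<noteq> b'"
  have "gamma_ri2 G \<le> card (verts G) - card {x, y}"
    using * adj_in_verts
    by (intro gamma_ri2_le_if_rainbow[of "{a, a'}" "{b, b'}"] independent_set_pair) auto
  then show ?thesis using *(1) by simp
qed

lemma gamma_ri2_le_card_minus_1:
  assumes "x \<rightarrow>\<^bsub>G\<^esub> a" "x \<rightarrow>\<^bsub>G\<^esub> b" "a \<noteq> b"
  shows "gamma_ri2 G \<le> card (verts G) - 1"
proof -
  have "independent_set G {a}" "independent_set G {b}"
    using assms adj_in_verts adj_not_same by (auto simp: independent_set_def)
  then show ?thesis using gamma_ri2_le_if_rainbow[of "{a}" "{b}" "{x}"] assms by auto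
qed

text \<open>Two vertices of value 0 each see both colours, and the colour classes are independent
  and disjoint.\<close>

lemma rainbow_pair_if_two_zeros:
  assumes f: "ri2_dominating G f" and two: "card (value_class G f 0) \<ge> 2"
  shows "rainbow_pair G"
proof -
  have "finite (value_class G f 0)" by (simp add: value_class_def)
  then obtain x y where xy: "x \<in> value_class G f 0" "y \<in> value_class G f 0" "x \<noteq> y"
    using two card_le_Suc0_iff_eq[of "value_class G f 0"] by auto
  have dom: "\<exists>u\<in>value_class G f i. v \<rightarrow>\<^bsub>G\<^esub> u"
    if "v \<in> value_class G f 0" "i \<in> {1, 2}" for v i
    using f that by (auto simp: ri2_dominating_def)
  have ind: "\<not> u \<rightarrow>\<^bsub>G\<^esub> v" if "u \<in> value_class G f i" "v \<in> value_class G f i" "i \<in> {1, 2}" for u v i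
    using f that by (auto simp: ri2_dominating_def independent_set_def)
  obtain a a' where a: "a \<in> value_class G f 1" "a' \<in> value_class G f 1" "x \<rightarrow>\<^bsub>G\<^esub> a" "y \<rightarrow>\<^bsub>G\<^esub> a'"
    using dom[of _ 1] xy by blast
  obtain b b' where b: "b \<in> value_class G f 2" "b' \<in> value_class G f 2" "x \<rightarrow>\<^bsub>G\<^esub> b" "y \<rightarrow>\<^bsub>G\<^esub> b'"
    using dom[of _ 2] xy by blast
  have "u \<noteq> v" if "u \<in> value_class G f 1" "v \<in> value_class G f 2" for u v
    using that by (auto simp: value_class_def)
  then show ?thesis
    using a b xy ind by (intro rainbow_pairI[where x = x and y = y and a = a and b = b and a' = a' and b' = b']) auto
qed

text \<open>A vertex with two neighbours bounds the number by the order minus 1. A smaller value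
  needs two zeros, which amounts to a rainbow pair.\<close>

lemma gamma_ri2_eq_iff_not_rainbow_pair:
  assumes "x \<rightarrow>\<^bsub>G\<^esub> a" "x \<rightarrow>\<^bsub>G\<^esub> b" "a \<noteq> b"
  shows "gamma_ri2 G = card (verts G) - 1 \<longleftrightarrow> \<not> rainbow_pair G"
proof -
  have "{x, a} \<subseteq> verts G" "x \<noteq> a" using assms(1) adj_in_verts adj_neq by auto
  \<comment> \<open>With truncated subtraction, this makes the order minus 2 smaller than the order
    minus 1.\<close>
  then have n: "card (verts G) \<ge> 2" using card_mono[of "verts G" "{x, a}"] by simp
  show ?thesis
  proof
    assume "gamma_ri2 G = card (verts G) - 1"
    then show "\<not> rainbow_pair G" using gamma_ri2_le_card_minus_2 n by auto
  next
    assume no: "\<not> rainbow_pair G"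
    obtain f where f: "ri2_dominating G f" "ri2_weight G f = gamma_ri2 G"
      by (rule gamma_ri2_attained)
    have "\<not> 2 \<le> card (value_class G f 0)"
      using rainbow_pair_if_two_zeros[OF f(1)] no by blast
    then show "gamma_ri2 G = card (verts G) - 1"
      using gamma_ri2_le_card_minus_1[OF assms] f(2) ri2_weight_conv[of f] by linarith
  qed
qed

end

subsection \<open>Recognising the extremal graphs\<close>

context graph
begin

lemma digraph_iso_starI:
  assumes c: "c \<in> verts G"
    and adj: "\<And>u v. u \<in> verts G \<Longrightarrow> v \<in> verts G \<Longrightarrow> u \<rightarrow>\<^bsub>G\<^esub> v \<longleftrightarrow> (u = c) \<noteq> (v = c)"
  shows "digraph_iso G (with_proj (star_graph (card (verts G) - 1)))"
proof -
  let ?n = "card (verts G)"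
  obtain h where h: "bij_betw h (verts G) {..<?n}"
    and pre: "\<And>i. i < length [c] \<Longrightarrow> h ([c] ! i) = i"
    using c by (rule_tac enumeration_with_prefix[of "verts G" "[c]"]) auto
  have "h c = 0" using pre[of 0] by simp
  then have h0: "h u = 0 \<longleftrightarrow> u = c" if "u \<in> verts G" for u
    using inj_on_eq_iff[OF bij_betw_imp_inj_on[OF h] that c] by simp
  have less: "h u < ?n" if "u \<in> verts G" for u
    using bij_betwE[OF h] that by blast
  have "?n > 0" using less[OF c] by simp
  then have img: "{..<?n} = {..?n - 1}" by auto
  show ?thesis
  proof (rule digraph_iso_with_projI[of h])
    show "bij_betw h (verts G) (pverts (star_graph (?n - 1)))"
      using h img by (simp add: pverts_extremal)
    show "parcs (star_graph (?n - 1)) \<subseteq> pverts (star_graph (?n - 1)) \<times> pverts (star_graph (?n - 1))"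
      by (auto simp: pverts_extremal parcs_star)
    fix u v assume uv: "u \<in> verts G" "v \<in> verts G"
    have "h u \<le> ?n - 1" "h v \<le> ?n - 1" using less[OF uv(1)] less[OF uv(2)] by simp_all
    then show "u \<rightarrow>\<^bsub>G\<^esub> v \<longleftrightarrow> (h u, h v) \<in> parcs (star_graph (?n - 1))"
      unfolding adj[OF uv] parcs_star h0[OF uv(1)] h0[OF uv(2)] by simp
  qed
qed

lemma digraph_iso_star_plusI:
  assumes V: "c \<in> verts G" "p \<in> verts G" "q \<in> verts G" and dist: "c \<noteq> p" "c \<noteq> q" "p \<noteq> q"
    and adj: "\<And>u v. u \<in> verts G \<Longrightarrow> v \<in> verts G \<Longrightarrow>
      u \<rightarrow>\<^bsub>G\<^esub> v \<longleftrightarrow> (u = c) \<noteq> (v = c) \<or> u = p \<and> v = q \<or> u = q \<and> v = p"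
  shows "digraph_iso G (with_proj (star_plus_graph (card (verts G) - 1)))"
proof -
  let ?n = "card (verts G)"
  obtain h where h: "bij_betw h (verts G) {..<?n}"
    and pre: "\<And>i. i < length [c, p, q] \<Longrightarrow> h ([c, p, q] ! i) = i"
    using V dist by (rule_tac enumeration_with_prefix[of "verts G" "[c, p, q]"]) auto
  have hs: "h c = 0" "h p = 1" "h q = 2" using pre[of 0] pre[of 1] pre[of 2] by simp_all
  have eq: "h u = h v \<longleftrightarrow> u = v" if "u \<in> verts G" "v \<in> verts G" for u v
    using inj_on_eq_iff[OF bij_betw_imp_inj_on[OF h] that] .
  have hc: "h u = 0 \<longleftrightarrow> u = c" "h u = 1 \<longleftrightarrow> u = p" "h u = 2 \<longleftrightarrow> u = q" if "u \<in> verts G" for u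
    using eq[OF that V(1)] eq[OF that V(2)] eq[OF that V(3)] hs by simp_all
  have less: "h u < ?n" if "u \<in> verts G" for u
    using bij_betwE[OF h] that by blast
  have n: "?n - 1 \<ge> 2" using less[OF V(3)] hs by simp
  then have img: "{..<?n} = {..?n - 1}" by auto
  show ?thesis
  proof (rule digraph_iso_with_projI[of h])
    show "bij_betw h (verts G) (pverts (star_plus_graph (?n - 1)))"
      using h img by (simp add: pverts_extremal)
    show "parcs (star_plus_graph (?n - 1)) \<subseteq>
        pverts (star_plus_graph (?n - 1)) \<times> pverts (star_plus_graph (?n - 1))"
      using n by (auto simp: pverts_extremal parcs_star_plus)
    fix u v assume uv: "u \<in> verts G" "v \<in> verts G"
    have "h u \<le> ?n - 1" "h v \<le> ?n - 1" using less[OF uv(1)] less[OF uv(2)] by simp_all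
    then show "u \<rightarrow>\<^bsub>G\<^esub> v \<longleftrightarrow> (h u, h v) \<in> parcs (star_plus_graph (?n - 1))"
      unfolding adj[OF uv] parcs_star_plus[OF n] hc[OF uv(1)] hc[OF uv(2)] by simp
  qed
qed

text \<open>Here \<open>c\<close> plays the role of \<open>u\<^sub>0\<close>, \<open>x\<close> that
  of \<open>v\<^sub>0\<close> and \<open>w\<close> that of \<open>v\<^sub>1\<close>; all other
  vertices are leaves at \<open>c\<close>.\<close>

lemma digraph_iso_double_starI:
  assumes V: "c \<in> verts G" "x \<in> verts G" "w \<in> verts G" and dist: "c \<noteq> x" "c \<noteq> w" "x \<noteq> w"
    and adj: "\<And>u v. u \<in> verts G \<Longrightarrow> v \<in> verts G \<Longrightarrow>
      u \<rightarrow>\<^bsub>G\<^esub> v \<longleftrightarrow> u = c \<and> v \<noteq> c \<and> v \<noteq> w \<or> v = c \<and> u \<noteq> c \<and> u \<noteq> w \<or> u = x \<and> v = w \<or> u = w \<and> v = x"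
  shows "digraph_iso G (with_proj (double_star_graph (card (verts G) - 3) 1))"
proof -
  let ?n = "card (verts G)" let ?H = "double_star_graph (card (verts G) - 3) 1"
  obtain h where h: "bij_betw h (verts G) {..<?n}"
    and pre: "\<And>i. i < length [c, x, w] \<Longrightarrow> h ([c, x, w] ! i) = i"
    using V dist by (rule_tac enumeration_with_prefix[of "verts G" "[c, x, w]"]) auto
  have hs: "h c = 0" "h x = 1" "h w = 2" using pre[of 0] pre[of 1] pre[of 2] by simp_all
  have eq: "h u = h v \<longleftrightarrow> u = v" if "u \<in> verts G" "v \<in> verts G" for u v
    using inj_on_eq_iff[OF bij_betw_imp_inj_on[OF h] that] .
  have hc: "h u = 0 \<longleftrightarrow> u = c" "h u = 1 \<longleftrightarrow> u = x" "h u = 2 \<longleftrightarrow> u = w" if "u \<in> verts G" for u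
    using eq[OF that V(1)] eq[OF that V(2)] eq[OF that V(3)] hs by simp_all
  have less: "h u < ?n" if "u \<in> verts G" for u
    using bij_betwE[OF h] that by blast
  have n: "?n \<ge> 3" using less[OF V(3)] hs by simp
  \<comment> \<open>The labels 0, 1, 2 of \<open>c\<close>, \<open>x\<close>, \<open>w\<close> go to
    their places; the labels from 3 to \<open>?n - 1\<close> become the leaf indices from 1 to
    \<open>?n - 3\<close>.\<close>
  define g :: "nat \<Rightarrow> nat + nat" where
    "g i = (if i = 0 then Inl 0 else if i = 1 then Inr 0 else if i = 2 then Inr 1 else Inl (i - 2))" for i
  have "inj_on g {..<?n}" by (rule inj_onI) (auto simp: g_def split: if_splits)
  moreover have "g ` {..<?n} = pverts ?H"
  proof (intro equalityI subsetI)
    fix z assume "z \<in> g ` {..<?n}"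
    then show "z \<in> pverts ?H" using n by (auto simp: g_def pverts_extremal split: if_splits)
  next
    fix z assume "z \<in> pverts ?H"
    then consider i where "z = Inl i" "i \<le> ?n - 3" | "z = Inr 0" | "z = Inr 1"
      unfolding pverts_extremal by (auto simp: le_Suc_eq)
    then show "z \<in> g ` {..<?n}"
    proof cases
      case (1 i)
      then show ?thesis using n
        by (intro image_eqI[of _ _ "if i = 0 then 0 else i + 2"]) (auto simp: g_def)
    next
      case 2 then show ?thesis using n by (intro image_eqI[of _ _ 1]) (auto simp: g_def)
    next
      case 3 then show ?thesis using n by (intro image_eqI[of _ _ 2]) (auto simp: g_def)
    qed
  qed
  ultimately have g: "bij_betw g {..<?n} (pverts ?H)" by (simp add: bij_betw_def)
  show ?thesis
  proof (rule digraph_iso_with_projI[of "g \<circ> h"])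
    show bij: "bij_betw (g \<circ> h) (verts G) (pverts ?H)" using h g by (rule bij_betw_trans)
    show "parcs ?H \<subseteq> pverts ?H \<times> pverts ?H" by (auto simp: parcs_double_star simp del: One_nat_def)
    fix u v assume uv: "u \<in> verts G" "v \<in> verts G"
    have in_H: "g (h u) \<in> pverts ?H" "g (h v) \<in> pverts ?H"
      using bij_betwE[OF bij] uv by auto
    have gh: "g (h z) = (if z = c then Inl 0 else if z = x then Inr 0
        else if z = w then Inr 1 else Inl (h z - 2))" if "z \<in> verts G" for z
      unfolding g_def hc[OF that] ..
    have ge: "h z - 2 \<noteq> 0" if "z \<in> verts G" "z \<noteq> c" "z \<noteq> x" "z \<noteq> w" for z
      using hc[OF that(1)] that(2-4) by linarith
    show "u \<rightarrow>\<^bsub>G\<^esub> v \<longleftrightarrow> ((g \<circ> h) u, (g \<circ> h) v) \<in> parcs ?H"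
      unfolding adj[OF uv] parcs_double_star comp_apply
      using in_H ge[OF uv(1)] ge[OF uv(2)] dist
      by (simp add: gh[OF uv(1)] gh[OF uv(2)] del: One_nat_def)
  qed
qed

text \<open>The list exhausts the vertices, so the position in it is the isomorphism.\<close>

lemma digraph_iso_by_listI:
  assumes xs: "distinct xs" "set xs = verts G" and H: "pverts H = {..<length xs}"
    "parcs H \<subseteq> pverts H \<times> pverts H"
    and adj: "\<And>i j. i < length xs \<Longrightarrow> j < length xs \<Longrightarrow> xs ! i \<rightarrow>\<^bsub>G\<^esub> xs ! j \<longleftrightarrow> (i, j) \<in> parcs H"
  shows "digraph_iso G (with_proj H)"
proof -
  have n: "card (verts G) = length xs" using xs distinct_card by fastforce
  obtain h where h: "bij_betw h (verts G) {..<card (verts G)}"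
    and pre: "\<And>i. i < length xs \<Longrightarrow> h (xs ! i) = i"
    using xs by (rule_tac enumeration_with_prefix[of "verts G" xs]) auto
  show ?thesis
  proof (rule digraph_iso_with_projI[of h])
    show "bij_betw h (verts G) (pverts H)" using h n H by simp
    show "parcs H \<subseteq> pverts H \<times> pverts H" by fact
    fix u v assume "u \<in> verts G" "v \<in> verts G"
    then obtain i j where "i < length xs" "u = xs ! i" "j < length xs" "v = xs ! j"
      using xs(2) by (metis in_set_conv_nth)
    then show "u \<rightarrow>\<^bsub>G\<^esub> v \<longleftrightarrow> (h u, h v) \<in> parcs H" using adj pre by simp
  qed
qed

lemma digraph_iso_cycle5I:
  assumes dist: "distinct [c, x, w, t, y]" and V: "verts G = {c, x, w, t, y}"
    and nbrs: "\<And>v. c \<rightarrow>\<^bsub>G\<^esub> v \<longleftrightarrow> v = x \<or> v = y" "\<And>v. x \<rightarrow>\<^bsub>G\<^esub> v \<longleftrightarrow> v = c \<or> v = w"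
      "\<And>v. w \<rightarrow>\<^bsub>G\<^esub> v \<longleftrightarrow> v = x \<or> v = t" "\<And>v. t \<rightarrow>\<^bsub>G\<^esub> v \<longleftrightarrow> v = w \<or> v = y"
      "\<And>v. y \<rightarrow>\<^bsub>G\<^esub> v \<longleftrightarrow> v = t \<or> v = c"
  shows "digraph_iso G (with_proj (cycle_graph 5))"
proof (rule digraph_iso_by_listI[OF dist])
  show "set [c, x, w, t, y] = verts G" using V by simp
  show "pverts (cycle_graph 5) = {..<length [c, x, w, t, y]}" by (simp add: pverts_extremal)
  show "parcs (cycle_graph 5) \<subseteq> pverts (cycle_graph 5) \<times> pverts (cycle_graph 5)"
    unfolding parcs_cycle5 pverts_extremal by simp
  have "\<forall>i\<in>{0, 1, 2, 3, 4}. \<forall>j\<in>{0, 1, 2, 3, 4}.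
      [c, x, w, t, y] ! i \<rightarrow>\<^bsub>G\<^esub> [c, x, w, t, y] ! j \<longleftrightarrow> (i, j) \<in> parcs (cycle_graph 5)"
    unfolding parcs_cycle5 using dist by (simp add: nbrs, blast)
  moreover have "i \<in> {0, 1, 2, 3, 4}" if "i < length [c, x, w, t, y]" for i
    using that by (simp, linarith)
  moreover fix i j assume "i < length [c, x, w, t, y]" "j < length [c, x, w, t, y]"
  ultimately show "[c, x, w, t, y] ! i \<rightarrow>\<^bsub>G\<^esub> [c, x, w, t, y] ! j \<longleftrightarrow> (i, j) \<in> parcs (cycle_graph 5)"
    by blast
qed

end

subsection \<open>Connected graphs without a rainbow pair\<close>

context graph
begin

text \<open>By symmetry, connectedness makes every vertex reachable from \<open>u\<close>, and
  closure propagates along walks. Often used in contrapositive form: an edge leaves every nonempty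
  proper subset of the vertices.\<close>

lemma adj_closed_eq_verts:
  assumes "connected G" "u \<in> S" "S \<subseteq> verts G" "\<And>x y. x \<in> S \<Longrightarrow> x \<rightarrow>\<^bsub>G\<^esub> y \<Longrightarrow> y \<in> S"
  shows "verts G = S"
proof
  show "verts G \<subseteq> S"
  proof
    fix v assume "v \<in> verts G"
    moreover have "strongly_connected G"
      using symmetric_connected_imp_strongly_connected[OF sym_arcs assms(1)] .
    ultimately have "u \<rightarrow>\<^sup>*\<^bsub>G\<^esub> v" using assms(2,3) by (auto simp: strongly_connected_def)
    then show "v \<in> S" by (induction rule: reachable_induct) (use assms in auto)
  qed
qed (fact assms(3))

text \<open>After an edge from \<open>u\<close> to \<open>w\<close> is found, a further edge leaves
  \<open>{u, w}\<close>; its end inside this set has two neighbours.\<close>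

lemma ex_vertex_with_two_neighbours:
  assumes conn: "connected G" and n: "card (verts G) \<ge> 3"
  obtains x a b where "x \<rightarrow>\<^bsub>G\<^esub> a" "x \<rightarrow>\<^bsub>G\<^esub> b" "a \<noteq> b"
proof -
  have small: "verts G \<noteq> S" if "card S < 3" for S using n that by auto
  obtain u where u: "u \<in> verts G" using n by fastforce
  obtain w where w: "u \<rightarrow>\<^bsub>G\<^esub> w"
    using adj_closed_eq_verts[OF conn, of u "{u}"] small[of "{u}"] u by auto
  have "card {u, w} < 3" by (simp add: card_insert_if)
  then obtain x y where xy: "x \<in> {u, w}" "x \<rightarrow>\<^bsub>G\<^esub> y" "y \<notin> {u, w}"
    using adj_closed_eq_verts[OF conn, of u "{u, w}"] small[of "{u, w}"] u adj_in_verts[OF w] by auto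
  show thesis
  proof (cases "x = u")
    case True then show thesis using that[of u w y] w xy by auto
  next
    case False
    then have "x = w" using xy by auto
    then show thesis using that[of w u y] w xy adj_sym by auto
  qed
qed

lemma finite_neighbourhood: "finite {v. u \<rightarrow>\<^bsub>G\<^esub> v}"
  by (rule finite_subset[OF _ finite_verts]) (auto dest: adj_in_verts(2))

lemma neighbours_eq_pair:
  assumes "card {v. u \<rightarrow>\<^bsub>G\<^esub> v} \<le> 2" "u \<rightarrow>\<^bsub>G\<^esub> a" "u \<rightarrow>\<^bsub>G\<^esub> b" "a \<noteq> b"
  shows "u \<rightarrow>\<^bsub>G\<^esub> v \<longleftrightarrow> v = a \<or> v = b"
proof -
  have "{a, b} = {v. u \<rightarrow>\<^bsub>G\<^esub> v}"
    using assms by (intro card_seteq[OF finite_neighbourhood]) auto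
  then show ?thesis by blast
qed

lemma ex_third_neighbour:
  assumes "card {v. u \<rightarrow>\<^bsub>G\<^esub> v} \<ge> 3"
  obtains z where "u \<rightarrow>\<^bsub>G\<^esub> z" "z \<noteq> a" "z \<noteq> b"
proof -
  have "card {a, b} < 3" by (simp add: card_insert_if)
  then have "\<not> {v. u \<rightarrow>\<^bsub>G\<^esub> v} \<subseteq> {a, b}"
    using assms card_mono[of "{a, b}" "{v. u \<rightarrow>\<^bsub>G\<^esub> v}"] by auto
  then show thesis using that by blast
qed

lemma three_neighbours_card:
  assumes "u \<rightarrow>\<^bsub>G\<^esub> a" "u \<rightarrow>\<^bsub>G\<^esub> b" "u \<rightarrow>\<^bsub>G\<^esub> d" "a \<noteq> b" "a \<noteq> d" "b \<noteq> d"
  shows "card {v. u \<rightarrow>\<^bsub>G\<^esub> v} \<ge> 3"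
  using card_mono[OF finite_neighbourhood[of u], of "{a, b, d}"] assms by simp

section \<open>Local structure and classification in the absence of rainbow pairs\<close>

context
  assumes no_pair: "\<not> rainbow_pair G"
begin

text \<open>Otherwise \<open>x\<close> and \<open>y\<close> form a rainbow pair with
  \<open>{a}\<close> as one colour and \<open>{b, b'}\<close> as the other. The case
  \<open>b = b'\<close> is included and yields a loop.\<close>

lemma common_neighbour_joined:
  assumes "a \<rightarrow>\<^bsub>G\<^esub> x" "a \<rightarrow>\<^bsub>G\<^esub> y" "x \<noteq> y" "x \<rightarrow>\<^bsub>G\<^esub> b" "b \<noteq> a" "y \<rightarrow>\<^bsub>G\<^esub> b'" "b' \<noteq> a"
  shows "b \<rightarrow>\<^bsub>G\<^esub> b'"
proof (rule ccontr)
  assume "\<not> b \<rightarrow>\<^bsub>G\<^esub> b'"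
  then have "rainbow_pair G"
    using assms adj_not_same adj_sym
    by (intro rainbow_pairI[where x = x and y = y and a = a and b = b and a' = a and b' = b']) auto
  then show False using no_pair by blast
qed

lemma common_neighbour_unique:
  assumes "x \<noteq> y" "x \<rightarrow>\<^bsub>G\<^esub> a" "y \<rightarrow>\<^bsub>G\<^esub> a" "x \<rightarrow>\<^bsub>G\<^esub> b" "y \<rightarrow>\<^bsub>G\<^esub> b"
  shows "a = b"
proof (rule ccontr)
  assume "a \<noteq> b"
  then have "b \<rightarrow>\<^bsub>G\<^esub> b"
    using common_neighbour_joined[of a x y b b] assms adj_sym by auto
  then show False by (rule adj_not_same)
qed

lemma universal_vertex_imp_star_or_star_plus:
  assumes c: "c \<in> verts G" and univ: "\<And>v. v \<in> verts G \<Longrightarrow> v \<noteq> c \<Longrightarrow> c \<rightarrow>\<^bsub>G\<^esub> v"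
  shows "digraph_iso G (with_proj (star_graph (card (verts G) - 1))) \<or>
    digraph_iso G (with_proj (star_plus_graph (card (verts G) - 1)))"
proof -
  have c_adj: "c \<rightarrow>\<^bsub>G\<^esub> v" if "u \<rightarrow>\<^bsub>G\<^esub> v" "v \<noteq> c" for u v
    using univ adj_in_verts(2)[OF that(1)] that(2) by blast
  \<comment> \<open>\<open>u\<close> and \<open>c\<close> have at most one common neighbour, so
    \<open>u\<close> has at most one neighbour besides \<open>c\<close>.\<close>
  have uniq: "v = v'" if "u \<rightarrow>\<^bsub>G\<^esub> v" "u \<rightarrow>\<^bsub>G\<^esub> v'" "u \<noteq> c" "v \<noteq> c" "v' \<noteq> c" for u v v'
    using common_neighbour_unique[OF that(3,1) c_adj[OF that(1,4)] that(2) c_adj[OF that(2,5)]] .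
  show ?thesis
  proof (cases "\<exists>p q. p \<noteq> c \<and> q \<noteq> c \<and> p \<rightarrow>\<^bsub>G\<^esub> q")
    case False
    have "u \<rightarrow>\<^bsub>G\<^esub> v \<longleftrightarrow> (u = c) \<noteq> (v = c)" if "u \<in> verts G" "v \<in> verts G" for u v
      using False univ[OF that(1)] univ[OF that(2)] adj_sym[of u v] adj_neq[of u v] by blast
    then show ?thesis using digraph_iso_starI[OF c] by blast
  next
    case True
    then obtain p q where pq: "p \<noteq> c" "q \<noteq> c" "p \<rightarrow>\<^bsub>G\<^esub> q" by blast
    have qp: "q \<rightarrow>\<^bsub>G\<^esub> p" using pq(3) adj_sym by blast
    have only: "u = p \<and> v = q \<or> u = q \<and> v = p" if "u \<noteq> c" "v \<noteq> c" "u \<rightarrow>\<^bsub>G\<^esub> v" for u v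
    proof -
      have vu: "v \<rightarrow>\<^bsub>G\<^esub> u" using that(3) adj_sym by blast
      \<comment> \<open>Otherwise \<open>c\<close> is a common neighbour of \<open>u\<close> and
        \<open>p\<close>, which joins \<open>v\<close> to \<open>q\<close>, and of \<open>u\<close>
        and \<open>q\<close>, which joins \<open>v\<close> to \<open>p\<close>. Then
        \<open>v\<close> has two neighbours besides \<open>c\<close>.\<close>
      have "u = p \<or> u = q"
      proof (rule ccontr)
        assume "\<not> ?thesis"
        then have "v \<rightarrow>\<^bsub>G\<^esub> q" "v \<rightarrow>\<^bsub>G\<^esub> p"
          using common_neighbour_joined[of c u p v q] common_neighbour_joined[of c u q v p]
            c_adj[OF vu that(1)] c_adj[OF pq(3,2)] c_adj[OF qp pq(1)] that pq qp by auto
        then show False using uniq[of v q p] that pq adj_neq[OF pq(3)] by blast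
      qed
      then show ?thesis using uniq[of u v] that pq qp by blast
    qed
    have "u \<rightarrow>\<^bsub>G\<^esub> v \<longleftrightarrow> (u = c) \<noteq> (v = c) \<or> u = p \<and> v = q \<or> u = q \<and> v = p"
      if "u \<in> verts G" "v \<in> verts G" for u v
      using only[of u v] univ[OF that(1)] univ[OF that(2)] adj_sym[of u v] adj_neq[of u v] pq qp
      by blast
    then have "digraph_iso G (with_proj (star_plus_graph (card (verts G) - 1)))"
      using pq c adj_in_verts[OF pq(3)] adj_neq[OF pq(3)]
      by (intro digraph_iso_star_plusI[of c p q]) auto
    then show ?thesis ..
  qed
qed

lemma no_universal_vertex_imp_double_star_or_cycle5:
  assumes conn: "connected G"
    and max: "\<And>u. u \<in> verts G \<Longrightarrow> card {v. u \<rightarrow>\<^bsub>G\<^esub> v} \<le> card {v. c \<rightarrow>\<^bsub>G\<^esub> v}"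
    and two: "card {v. c \<rightarrow>\<^bsub>G\<^esub> v} \<ge> 2"
    and cx: "c \<rightarrow>\<^bsub>G\<^esub> x" and xw: "x \<rightarrow>\<^bsub>G\<^esub> w" and w: "w \<noteq> c" "\<not> c \<rightarrow>\<^bsub>G\<^esub> w"
  shows "(card (verts G) \<ge> 4 \<and> digraph_iso G (with_proj (double_star_graph (card (verts G) - 3) 1))) \<or>
    digraph_iso G (with_proj (cycle_graph 5))"
proof -
  note V = adj_in_verts[OF cx] adj_in_verts(2)[OF xw]
  have xc: "x \<rightarrow>\<^bsub>G\<^esub> c" and wx: "w \<rightarrow>\<^bsub>G\<^esub> x" using cx xw adj_sym by blast+
  have "\<not> {v. c \<rightarrow>\<^bsub>G\<^esub> v} \<subseteq> {x}"
    using two card_mono[of "{x}" "{v. c \<rightarrow>\<^bsub>G\<^esub> v}"] by auto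
  then obtain y where y: "c \<rightarrow>\<^bsub>G\<^esub> y" "y \<noteq> x" by blast
  have yc: "y \<rightarrow>\<^bsub>G\<^esub> c" using y(1) adj_sym by blast
  \<comment> \<open>\<open>c\<close> and \<open>w'\<close> have the common neighbour
    \<open>x\<close>, so their other neighbours are joined.\<close>
  have join: "y' \<rightarrow>\<^bsub>G\<^esub> t" if "c \<rightarrow>\<^bsub>G\<^esub> y'" "y' \<noteq> x" "w' \<rightarrow>\<^bsub>G\<^esub> t" "t \<noteq> x" "x \<rightarrow>\<^bsub>G\<^esub> w'" "w' \<noteq> c" for y' w' t
    using common_neighbour_joined[OF xc that(5) _ that(1,2,3,4)] that(6) by blast
  show ?thesis
  proof (cases "\<exists>w' t. x \<rightarrow>\<^bsub>G\<^esub> w' \<and> w' \<noteq> c \<and> \<not> c \<rightarrow>\<^bsub>G\<^esub> w' \<and> w' \<rightarrow>\<^bsub>G\<^esub> t \<and> t \<noteq> x")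
    case True
    then obtain w t where w: "x \<rightarrow>\<^bsub>G\<^esub> w" "w \<noteq> c" "\<not> c \<rightarrow>\<^bsub>G\<^esub> w" and t: "w \<rightarrow>\<^bsub>G\<^esub> t" "t \<noteq> x" by blast
    have wx: "w \<rightarrow>\<^bsub>G\<^esub> x" and tw: "t \<rightarrow>\<^bsub>G\<^esub> w" using w t adj_sym by blast+
    have tc: "t \<noteq> c" using t(1) w(3) adj_sym by blast
    have yt: "y \<rightarrow>\<^bsub>G\<^esub> t" using join[OF y t w(1,2)] .
    have ty: "t \<rightarrow>\<^bsub>G\<^esub> y" using yt adj_sym by blast
    \<comment> \<open>By \<open>join\<close>, \<open>t\<close> is adjacent to every neighbour of
      \<open>c\<close> other than \<open>x\<close>; two such neighbours would be shared by
      \<open>t\<close> and \<open>c\<close>. So \<open>c\<close> has degree 2, which bounds all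
      degrees.\<close>
    have "y' = y" if "c \<rightarrow>\<^bsub>G\<^esub> y'" "y' \<noteq> x" for y'
    proof -
      have "t \<rightarrow>\<^bsub>G\<^esub> y'" using join[OF that t w(1,2)] adj_sym by blast
      then show ?thesis using common_neighbour_unique[OF tc _ that(1) ty y(1)] by blast
    qed
    then have "{v. c \<rightarrow>\<^bsub>G\<^esub> v} \<subseteq> {x, y}" by blast
    then have "card {v. c \<rightarrow>\<^bsub>G\<^esub> v} \<le> card {x, y}" by (intro card_mono) auto
    then have deg: "card {v. u \<rightarrow>\<^bsub>G\<^esub> v} \<le> 2" if "u \<in> verts G" for u
      using max[OF that] y(2) by simp
    have wy: "w \<noteq> y" using w(3) y(1) by blast
    note Vs = V(1,2) adj_in_verts(1)[OF wx] adj_in_verts[OF ty]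
    have dist: "distinct [c, x, w, t, y]"
      using adj_neq[OF cx] w(2) tc adj_neq[OF y(1)] adj_neq[OF w(1)] t(2) y(2) adj_neq[OF t(1)] wy
        adj_neq[OF ty] by auto
    have nbrs: "\<And>v. c \<rightarrow>\<^bsub>G\<^esub> v \<longleftrightarrow> v = x \<or> v = y" "\<And>v. x \<rightarrow>\<^bsub>G\<^esub> v \<longleftrightarrow> v = c \<or> v = w"
      "\<And>v. w \<rightarrow>\<^bsub>G\<^esub> v \<longleftrightarrow> v = x \<or> v = t" "\<And>v. t \<rightarrow>\<^bsub>G\<^esub> v \<longleftrightarrow> v = w \<or> v = y"
      "\<And>v. y \<rightarrow>\<^bsub>G\<^esub> v \<longleftrightarrow> v = t \<or> v = c"
      using neighbours_eq_pair[OF deg[OF Vs(1)] cx y(1)] neighbours_eq_pair[OF deg[OF Vs(2)] xc w(1)]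
        neighbours_eq_pair[OF deg[OF Vs(3)] wx t(1)] neighbours_eq_pair[OF deg[OF Vs(4)] tw ty]
        neighbours_eq_pair[OF deg[OF Vs(5)] yt yc] dist by auto
    \<comment> \<open>Each of the five vertices already has both its neighbours on the cycle, so the
      set is closed under adjacency.\<close>
    have "verts G = {c, x, w, t, y}"
      using Vs by (intro adj_closed_eq_verts[OF conn, of c]) (auto simp: nbrs)
    then show ?thesis using digraph_iso_cycle5I[OF dist _ nbrs] by blast
  next
    case False
    then have leaf: "t = x" if "x \<rightarrow>\<^bsub>G\<^esub> w'" "w' \<noteq> c" "\<not> c \<rightarrow>\<^bsub>G\<^esub> w'" "w' \<rightarrow>\<^bsub>G\<^esub> t" for w' t
      using that by blast
    \<comment> \<open>No triangle contains \<open>c\<close> and \<open>x\<close>: it would give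
      \<open>x\<close> degree at least 3, hence by maximality \<open>c\<close> a third neighbour
      \<open>z\<close>. The common neighbour \<open>y'\<close> of \<open>x\<close> and
      \<open>c\<close> then joins \<open>w\<close> to \<open>z\<close>, although \<open>x\<close> is
      the only neighbour of \<open>w\<close>.\<close>
    have not_adj: "\<not> x \<rightarrow>\<^bsub>G\<^esub> y'" if y': "c \<rightarrow>\<^bsub>G\<^esub> y'" for y'
    proof
      assume xy': "x \<rightarrow>\<^bsub>G\<^esub> y'"
      have "y' \<noteq> w" using y' w(2) by blast
      then have "card {v. x \<rightarrow>\<^bsub>G\<^esub> v} \<ge> 3"
        using three_neighbours_card[OF xc xw xy'] w(1) adj_neq[OF y'] by blast
      then have "card {v. c \<rightarrow>\<^bsub>G\<^esub> v} \<ge> 3" using max[OF V(2)] by simp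
      then obtain z where z: "c \<rightarrow>\<^bsub>G\<^esub> z" "z \<noteq> x" "z \<noteq> y'" by (rule ex_third_neighbour)
      have "y' \<rightarrow>\<^bsub>G\<^esub> x" "y' \<rightarrow>\<^bsub>G\<^esub> c" using xy' y' adj_sym by blast+
      then have "w \<rightarrow>\<^bsub>G\<^esub> z"
        using common_neighbour_joined[of y' x c w z] xw z \<open>y' \<noteq> w\<close> adj_neq[OF cx] by blast
      then show False using leaf[OF xw w] z(2) by blast
    qed
    \<comment> \<open>A further neighbour \<open>t\<close> of \<open>y'\<close> would be joined to
      \<open>w\<close> through the common neighbour \<open>c\<close> of \<open>x\<close> and
      \<open>y'\<close>. Hence \<open>t = x\<close>, which closes a triangle.\<close>
    have leaf': "t = c" if "c \<rightarrow>\<^bsub>G\<^esub> y'" "y' \<noteq> x" "y' \<rightarrow>\<^bsub>G\<^esub> t" for y' t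
    proof (rule ccontr)
      assume "t \<noteq> c"
      then have "w \<rightarrow>\<^bsub>G\<^esub> t"
        using common_neighbour_joined[of c x y' w t] cx that xw w(1) by blast
      then have "t = x" using leaf[OF xw w] by blast
      then show False using not_adj[OF that(1)] that(3) adj_sym by blast
    qed
    \<comment> \<open>A third neighbour \<open>v\<close> of \<open>x\<close> is, like
      \<open>w\<close>, a leaf at \<open>x\<close>, and maximality gives \<open>c\<close> a third
      neighbour \<open>z\<close>. Then \<open>x\<close> and \<open>c\<close> form a rainbow pair
      with colours \<open>{w, y}\<close> and \<open>{v, z}\<close>.\<close>
    have x_nbrs: "v = c \<or> v = w" if xv: "x \<rightarrow>\<^bsub>G\<^esub> v" for v
    proof (rule ccontr)
      assume v: "\<not> ?thesis"
      then have "card {v. x \<rightarrow>\<^bsub>G\<^esub> v} \<ge> 3"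
        using three_neighbours_card[OF xc xw xv] w(1) by blast
      then have "card {v. c \<rightarrow>\<^bsub>G\<^esub> v} \<ge> 3" using max[OF V(2)] by simp
      then obtain z where z: "c \<rightarrow>\<^bsub>G\<^esub> z" "z \<noteq> x" "z \<noteq> y" by (rule ex_third_neighbour)
      have cv: "\<not> c \<rightarrow>\<^bsub>G\<^esub> v" using not_adj xv by blast
      have "\<not> w \<rightarrow>\<^bsub>G\<^esub> y" "\<not> v \<rightarrow>\<^bsub>G\<^esub> z"
        using leaf[OF xw w] leaf[OF xv _ cv] v y z by blast+
      then have "rainbow_pair G"
        using xw xv y z v w cv adj_neq[OF cx]
        by (intro rainbow_pairI[where x = x and y = c and a = w and b = v and a' = y and b' = z]) auto
      then show False using no_pair by blast
    qed
    let ?S = "insert c (insert w {v. c \<rightarrow>\<^bsub>G\<^esub> v})"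
    have S: "verts G = ?S"
    proof (rule adj_closed_eq_verts[OF conn, of c])
      show "?S \<subseteq> verts G" using V adj_in_verts(2) by auto
      fix u v assume "u \<in> ?S" and uv: "u \<rightarrow>\<^bsub>G\<^esub> v"
      then consider "u = c" | "u = w" | "u = x" | "c \<rightarrow>\<^bsub>G\<^esub> u" "u \<noteq> x" by blast
      then show "v \<in> ?S"
        using uv leaf[OF xw w, of v] x_nbrs[of v] leaf'[of u v] cx by cases auto
    qed simp
    have adj: "u \<rightarrow>\<^bsub>G\<^esub> v \<longleftrightarrow>
        u = c \<and> v \<noteq> c \<and> v \<noteq> w \<or> v = c \<and> u \<noteq> c \<and> u \<noteq> w \<or> u = x \<and> v = w \<or> u = w \<and> v = x"
      if "u \<in> verts G" "v \<in> verts G" for u v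
    proof -
      have cadj: "c \<rightarrow>\<^bsub>G\<^esub> z \<longleftrightarrow> z \<noteq> c \<and> z \<noteq> w" if "z \<in> verts G" for z
        using that S w(2) adj_neq[of c z] by blast
      have xadj: "x \<rightarrow>\<^bsub>G\<^esub> z \<longleftrightarrow> z = c \<or> z = w" for z using x_nbrs xc xw by blast
      have wadj: "w \<rightarrow>\<^bsub>G\<^esub> z \<longleftrightarrow> z = x" for z using leaf[OF xw w] wx by blast
      have ladj: "y' \<rightarrow>\<^bsub>G\<^esub> z \<longleftrightarrow> z = c" if "c \<rightarrow>\<^bsub>G\<^esub> y'" "y' \<noteq> x" for y' z
        using leaf'[OF that] that(1) adj_sym by blast
      have ne: "c \<noteq> x" "x \<noteq> w" using adj_neq[OF cx] adj_neq[OF xw] .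
      consider "u = c" | "u = w" | "u = x" | "c \<rightarrow>\<^bsub>G\<^esub> u" "u \<noteq> x" "u \<noteq> c" "u \<noteq> w"
        using \<open>u \<in> verts G\<close> S w(2) adj_neq[of c u] by blast
      then show ?thesis
        using cadj[OF \<open>v \<in> verts G\<close>] xadj[of v] wadj[of v] ladj[of u v] ne w(1) by cases auto
    qed
    \<comment> \<open>The second neighbour \<open>y\<close> of \<open>c\<close> is the fourth
      vertex.\<close>
    have "y \<noteq> w" "y \<noteq> c" using y(1) w(2) adj_neq[OF y(1)] by auto
    then have "card {c, x, w, y} = 4"
      using adj_neq[OF cx] adj_neq[OF xw] w(1) y(2) by auto
    moreover have "{c, x, w, y} \<subseteq> verts G" using V adj_in_verts(2)[OF y(1)] by auto
    ultimately have "card (verts G) \<ge> 4" using card_mono[OF finite_verts] by metis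
    moreover have "digraph_iso G (with_proj (double_star_graph (card (verts G) - 3) 1))"
      using adj_neq[OF cx] adj_neq[OF xw] w(1)
      by (intro digraph_iso_double_starI[OF V(1,2,3) _ _ _ adj]) auto
    ultimately show ?thesis by blast
  qed
qed

lemma connected_not_rainbow_pair_imp_extremal:
  assumes conn: "connected G" and n: "card (verts G) \<ge> 3"
  shows "digraph_iso G (with_proj (star_graph (card (verts G) - 1)))
    \<or> digraph_iso G (with_proj (star_plus_graph (card (verts G) - 1)))
    \<or> (card (verts G) \<ge> 4 \<and> digraph_iso G (with_proj (double_star_graph (card (verts G) - 3) 1)))
    \<or> digraph_iso G (with_proj (cycle_graph 5))"
proof -
  let ?deg = "\<lambda>u. card {v. u \<rightarrow>\<^bsub>G\<^esub> v}"
  obtain z a b where z: "z \<rightarrow>\<^bsub>G\<^esub> a" "z \<rightarrow>\<^bsub>G\<^esub> b" "a \<noteq> b"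
    using ex_vertex_with_two_neighbours[OF conn n] .
  have zV: "z \<in> verts G" using adj_in_verts(1)[OF z(1)] .
  have "Max (?deg ` verts G) \<in> ?deg ` verts G" using zV by (intro Max_in) auto
  then obtain c where c: "c \<in> verts G" "?deg c = Max (?deg ` verts G)" by auto
  have max: "?deg u \<le> ?deg c" if "u \<in> verts G" for u
    unfolding c(2) using that by (intro Max_ge) auto
  have "card {a, b} \<le> ?deg z" using z by (intro card_mono finite_neighbourhood) auto
  then have two: "?deg c \<ge> 2" using max[OF zV] z(3) by simp
  show ?thesis
  proof (cases "\<forall>v\<in>verts G. v \<noteq> c \<longrightarrow> c \<rightarrow>\<^bsub>G\<^esub> v")
    case True
    then show ?thesis using universal_vertex_imp_star_or_star_plus[OF c(1)] by blast
  next
    case False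
    let ?S = "insert c {v. c \<rightarrow>\<^bsub>G\<^esub> v}"
    have "verts G \<noteq> ?S" using False by blast
    moreover have "?S \<subseteq> verts G" using c(1) adj_in_verts(2) by auto
    \<comment> \<open>An edge leaves the closed neighbourhood of \<open>c\<close>. It cannot start
      at \<open>c\<close>, so it starts at a neighbour \<open>x\<close> and ends at distance
      2.\<close>
    ultimately obtain x w where "x \<in> ?S" and xw: "x \<rightarrow>\<^bsub>G\<^esub> w" and "w \<notin> ?S"
      using adj_closed_eq_verts[OF conn, of c ?S] by auto
    then have "c \<rightarrow>\<^bsub>G\<^esub> x" "w \<noteq> c" "\<not> c \<rightarrow>\<^bsub>G\<^esub> w" by auto
    then show ?thesis
      using no_universal_vertex_imp_double_star_or_cycle5[OF conn max two _ xw] by blast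
  qed
qed

end

text \<open>A rainbow pair would carry over to the model graph, which has none. The order bound
  gives \<open>star_plus_graph\<close> the two leaves that its added edge joins.\<close>

lemma extremal_imp_not_rainbow_pair:
  assumes n: "card (verts G) \<ge> 3"
    and iso: "digraph_iso G (with_proj (star_graph m))
      \<or> digraph_iso G (with_proj (star_plus_graph (card (verts G) - 1)))
      \<or> digraph_iso G (with_proj (double_star_graph k 1))
      \<or> digraph_iso G (with_proj (cycle_graph 5))"
  shows "\<not> rainbow_pair G"
proof -
  have "card (verts G) - 1 \<ge> 2" using n by simp
  then show ?thesis
    using iso rainbow_pair_iso[of "star_graph m"] rainbow_pair_iso[of "double_star_graph k 1"]
      rainbow_pair_iso[of "star_plus_graph (card (verts G) - 1)"] rainbow_pair_iso[of "cycle_graph 5"]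
      not_rainbow_pair_star not_rainbow_pair_star_plus
      not_rainbow_pair_double_star not_rainbow_pair_cycle5 by blast
qed

end

theorem theorem3:
  fixes G :: "('a, 'b) pre_digraph" and n :: nat
  assumes "graph G" and "connected G"
    and "card (verts G) = n" and "n \<ge> 3"
  shows "gamma_ri2 G = n - 1 \<longleftrightarrow>
      digraph_iso G (with_proj (star_graph (n - 1)))
    \<or> digraph_iso G (with_proj (star_plus_graph (n - 1)))
    \<or> (n \<ge> 4 \<and> digraph_iso G (with_proj (double_star_graph (n - 3) 1)))
    \<or> digraph_iso G (with_proj (cycle_graph 5))"
proof -
  interpret graph G by fact
  have n: "card (verts G) \<ge> 3" using assms(3,4) by simp
  \<comment> \<open>Such a vertex makes the left-hand side equivalent to the absence of rainbow
    pairs; what remains is the classification and its converse.\<close>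
  obtain x a b where "x \<rightarrow>\<^bsub>G\<^esub> a" "x \<rightarrow>\<^bsub>G\<^esub> b" "a \<noteq> b"
    using ex_vertex_with_two_neighbours[OF assms(2) n] .
  then have "gamma_ri2 G = card (verts G) - 1 \<longleftrightarrow> \<not> rainbow_pair G"
    by (rule gamma_ri2_eq_iff_not_rainbow_pair)
  then show ?thesis
    using connected_not_rainbow_pair_imp_extremal[OF _ assms(2) n] extremal_imp_not_rainbow_pair[OF n]
    unfolding assms(3) by blast
qed

end
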